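(* Let $s\geq 3$ and $n\geq 4s+3$ be integers with $\gcd(n,s)=1$. The circulant graph $\mathrm{circ}(n;\pm1,\pm s)$ is $3$-spanning cyclable.
   Context: $\mathrm{circ}(n;\pm1,\pm s)$ is the Cayley graph on $\mathbb{Z}/n\mathbb{Z}$ with connection set $\{\pm1,\pm s\}$: vertices $u_0,\dots,u_{n-1}$ (indices mod $n$), with $u_i$ adjacent to $u_{i\pm1}$ and $u_{i\pm s}$. A 2-factor of a graph is a spanning subgraph in which every vertex has valency 2; it separates a set $A$ of $k$ vertices if it consists of exactly $k$ cycles and $A$ meets the vertex set of each cycle in exactly one vertex. A graph $X$ is $k$-spanning cyclable if for every $A\subseteq V(X)$ with $|A|=k$ there is a 2-factor of $X$ separating $A$. *)

theory Defs
  imports Main "HOL-Library.Disjoint_Sets"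
begin

text \<open>A graph is given by a vertex set \<open>V\<close> and a set \<open>E\<close> of edges, each edge being the set of its two
  end vertices. A spanning subgraph is given by its edge set \<open>F \<subseteq> E\<close>.\<close>

definition valency :: "'a set set \<Rightarrow> 'a \<Rightarrow> nat" where
  "valency F v = card {e \<in> F. v \<in> e}"

definition two_factor :: "'a set \<Rightarrow> 'a set set \<Rightarrow> 'a set set \<Rightarrow> bool" where
  "two_factor V E F \<longleftrightarrow> F \<subseteq> E \<and> (\<forall>v\<in>V. valency F v = 2)"

text \<open>Cycles are also represented by their edge sets; the vertex set of a cycle \<open>C\<close> is \<open>\<Union>C\<close>.\<close>

definition is_cycle :: "'a set set \<Rightarrow> bool" where
  "is_cycle C \<longleftrightarrow> (\<exists>xs. distinct xs \<and> length xs \<ge> 3 \<and>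
     C = {{xs ! i, xs ! ((i + 1) mod length xs)} | i. i < length xs})"

definition consists_of_cycles :: "'a set set \<Rightarrow> 'a set set set \<Rightarrow> bool" where
  "consists_of_cycles F Cs \<longleftrightarrow>
     (\<forall>C\<in>Cs. is_cycle C) \<and> disjoint_family_on (\<lambda>C. \<Union>C) Cs \<and> F = \<Union>Cs"

text \<open>The cycles of a finite 2-factor are its connected components, so the set \<open>Cs\<close> below is
  determined by \<open>F\<close>.\<close>

definition separates :: "'a set set \<Rightarrow> 'a set \<Rightarrow> bool" where
  "separates F A \<longleftrightarrow> (\<exists>Cs. consists_of_cycles F Cs \<and> finite Cs \<and> card Cs = card A \<and>
     (\<forall>C\<in>Cs. card (A \<inter> \<Union>C) = 1))"

definition spanning_cyclable :: "nat \<Rightarrow> 'a set \<Rightarrow> 'a set set \<Rightarrow> bool" where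
  "spanning_cyclable k V E \<longleftrightarrow>
     (\<forall>A. A \<subseteq> V \<and> finite A \<and> card A = k \<longrightarrow> (\<exists>F. two_factor V E F \<and> separates F A))"

text \<open>The Cayley graph on the integers modulo \<open>n\<close>, with residue classes represented by
  \<open>0, \<dots>, n - 1\<close>. The connection set \<open>S\<close> should be closed under negation and contain no multiple
  of \<open>n\<close>; a multiple of \<open>n\<close> would give singleton edges.\<close>

definition circulant_verts :: "int \<Rightarrow> int set" where
  "circulant_verts n = {0..<n}"

definition circulant_edges :: "int \<Rightarrow> int set \<Rightarrow> int set set" where
  "circulant_edges n S = {{x, (x + d) mod n} | x d. x \<in> circulant_verts n \<and> d \<in> S}"

end

theory Submission
  imports Defs
begin

text \<open>Call \<open>{i, i + 1, i + s, i + s + 1}\<close> the quad at \<open>i\<close>. If the windows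
  \<open>[i - 1, i + s + 2]\<close> and \<open>[j - 1, j + s + 2]\<close> overlap at most in their end points, the quads at
  \<open>i\<close> and \<open>j\<close> span 4-cycles and the remaining vertices span one cycle: follow the unit steps, but
  on reaching \<open>i - 1\<close> jump to \<open>i + s - 1\<close>, walk back to \<open>i + 2\<close> and jump to \<open>i + s + 2\<close>, and
  likewise at \<open>j\<close>. It remains to choose such quads so that each contains exactly one of the three
  given vertices and the third vertex lies in neither. Rotating so that the largest gap between
  the three vertices is the one from the last to the first, one can always put the outer two
  vertices into the quads, except for \<open>n = 15\<close> and \<open>s = 3\<close>, which are not coprime.\<close>

section \<open>Cycles and 2-factors given by lists of vertices\<close>

definition cycle_edges :: "'a list \<Rightarrow> 'a set set" where
  "cycle_edges xs = {{xs ! i, xs ! ((i + 1) mod length xs)} | i. i < length xs}"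

lemma Union_cycle_edges: "\<Union>(cycle_edges xs) = set xs"
proof
  have "xs ! ((i + 1) mod length xs) \<in> set xs" if "i < length xs" for i
    using that by (intro nth_mem mod_less_divisor) auto
  then show "\<Union>(cycle_edges xs) \<subseteq> set xs"
    by (auto simp: cycle_edges_def)
  show "set xs \<subseteq> \<Union>(cycle_edges xs)"
  proof
    fix v assume "v \<in> set xs"
    then obtain k where k: "k < length xs" "v = xs ! k"
      by (auto simp: in_set_conv_nth)
    then have "{v, xs ! ((k + 1) mod length xs)} \<in> cycle_edges xs"
      unfolding cycle_edges_def by blast
    then show "v \<in> \<Union>(cycle_edges xs)" by blast
  qed
qed

lemma is_cycle_cycle_edges:
  assumes "distinct xs" "length xs \<ge> 3"
  shows "is_cycle (cycle_edges xs)"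
  using assms unfolding is_cycle_def cycle_edges_def by blast

lemma card_cycle_edges_at:
  assumes d: "distinct xs" and l: "length xs \<ge> 3" and v: "v \<in> set xs"
  shows "card {e \<in> cycle_edges xs. v \<in> e} = 2"
proof -
  let ?n = "length xs"
  obtain k where k: "k < ?n" "v = xs ! k"
    using v by (auto simp: in_set_conv_nth)
  \<comment> \<open>The positions cyclically before and after \<open>k\<close>; the case
    distinctions handle the two ends of the list.\<close>
  define p where "p = (if k = 0 then ?n - 1 else k - 1)"
  define q where "q = (if k = ?n - 1 then 0 else k + 1)"
  have pq: "p < ?n" "q < ?n" "p \<noteq> k" "q \<noteq> k" "p \<noteq> q"
    using k l by (auto simp: p_def q_def)
  have suc: "(i + 1) mod ?n = (if i = ?n - 1 then 0 else i + 1)" if "i < ?n" for i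
    using that by (auto simp: mod_if)
  have "{e \<in> cycle_edges xs. v \<in> e} = {{xs ! p, xs ! k}, {xs ! k, xs ! q}}" (is "?L = ?R")
  proof
    show "?L \<subseteq> ?R"
    proof
      fix e assume e: "e \<in> ?L"
      then obtain i where i: "i < ?n" "e = {xs ! i, xs ! ((i + 1) mod ?n)}"
        by (auto simp: cycle_edges_def)
      have "(i + 1) mod ?n < ?n" using i by (intro mod_less_divisor) auto
      then have "k = i \<or> k = (i + 1) mod ?n"
        using e i k d by (auto simp: nth_eq_iff_index_eq)
      then have "(k = i \<and> (i + 1) mod ?n = q) \<or> (i = p \<and> (i + 1) mod ?n = k)"
        using suc[OF i(1)] i(1) by (auto simp: p_def q_def split: if_splits)
      then show "e \<in> ?R" using i(2) by auto
    qed
    have "(p + 1) mod ?n = k" "(k + 1) mod ?n = q"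
      using suc[OF pq(1)] suc[OF k(1)] k l by (auto simp: p_def q_def split: if_splits)
    then have "{xs ! p, xs ! k} \<in> cycle_edges xs" "{xs ! k, xs ! q} \<in> cycle_edges xs"
      using pq(1) k(1) unfolding cycle_edges_def by blast+
    then show "?R \<subseteq> ?L" using k(2) by auto
  qed
  \<comment> \<open>Three vertices or more make \<open>p\<close> and \<open>q\<close> differ; on two
    vertices both edges would coincide.\<close>
  moreover have "{xs ! p, xs ! k} \<noteq> {xs ! k, xs ! q}"
    using pq k d by (auto simp: doubleton_eq_iff nth_eq_iff_index_eq)
  ultimately show ?thesis by simp
qed

text \<open>Separates the closing edge from the others, so that a cycle glued from segments can be
  checked with \<open>successively\<close>.\<close>

lemma cycle_edges_subset:
  assumes "successively (\<lambda>a b. {a, b} \<in> E) xs" "{last xs, hd xs} \<in> E"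
  shows "cycle_edges xs \<subseteq> E"
proof
  fix e assume "e \<in> cycle_edges xs"
  then obtain i where i: "i < length xs" "e = {xs ! i, xs ! ((i + 1) mod length xs)}"
    by (auto simp: cycle_edges_def)
  show "e \<in> E"
  proof (cases "i + 1 < length xs")
    case True
    then show ?thesis using assms(1) i by (auto simp: successively_conv_nth)
  next
    case False
    then have l: "length xs = i + 1" using i(1) by simp
    then have "i = length xs - 1" "(i + 1) mod length xs = 0" "xs \<noteq> []" by auto
    then show ?thesis using assms(2) i by (simp add: last_conv_nth hd_conv_nth)
  qed
qed

text \<open>By disjointness every edge at a vertex comes from the one list through it, so valency 2
  is inherited from that single cycle.\<close>

lemma separating_two_factor:
  assumes fin: "finite L"
    and cyc: "\<And>xs. xs \<in> L \<Longrightarrow> distinct xs \<and> length xs \<ge> 3 \<and> cycle_edges xs \<subseteq> E"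
    and disj: "disjoint_family_on set L"
    and cover: "(\<Union>xs\<in>L. set xs) = V"
    and card: "card L = card A" "\<And>xs. xs \<in> L \<Longrightarrow> card (A \<inter> set xs) = 1"
  shows "\<exists>F. two_factor V E F \<and> separates F A"
proof (intro exI conjI)
  define F where "F = \<Union>(cycle_edges ` L)"
  have same: "xs = ys" if "xs \<in> L" "ys \<in> L" "v \<in> set xs" "v \<in> set ys" for xs ys v
    using disj that unfolding disjoint_family_on_def by blast
  \<comment> \<open>Makes the number of cycles equal the number of lists: equal edge sets give equal
    vertex sets, and the lists are nonempty and disjoint.\<close>
  have inj: "inj_on cycle_edges L"
  proof (rule inj_onI)
    fix xs ys assume L: "xs \<in> L" "ys \<in> L" and eq: "cycle_edges xs = cycle_edges ys"
    have "xs \<noteq> []" using cyc[OF L(1)] by auto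
    moreover have "set xs = set ys" using eq Union_cycle_edges by metis
    ultimately show "xs = ys" using same[OF L, of "hd xs"] hd_in_set by metis
  qed
  have "valency F v = 2" if "v \<in> V" for v
  proof -
    obtain xs where xs: "xs \<in> L" "v \<in> set xs" using \<open>v \<in> V\<close> cover by auto
    have "v \<in> set ys" if "e \<in> cycle_edges ys" "v \<in> e" for e ys
      using that Union_cycle_edges[of ys] by blast
    then have "{e \<in> F. v \<in> e} = {e \<in> cycle_edges xs. v \<in> e}"
      using same xs unfolding F_def by blast
    then show ?thesis
      using card_cycle_edges_at[of xs v] cyc xs by (simp add: valency_def)
  qed
  then show "two_factor V E F"
    using cyc by (auto simp: two_factor_def F_def)
  have "disjoint_family_on (\<lambda>C. \<Union>C) (cycle_edges ` L)"
    using same by (fastforce simp: disjoint_family_on_def Union_cycle_edges)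
  then have "consists_of_cycles F (cycle_edges ` L)"
    using cyc is_cycle_cycle_edges by (auto simp: consists_of_cycles_def F_def)
  then show "separates F A"
    using fin card card_image[OF inj] unfolding separates_def
    by (intro exI[of _ "cycle_edges ` L"]) (auto simp: Union_cycle_edges)
qed

lemma separating_two_factor_3:
  assumes cyc: "\<And>xs. xs \<in> {as, bs, cs} \<Longrightarrow> length xs \<ge> 3 \<and> cycle_edges xs \<subseteq> E"
    and dist: "distinct (as @ bs @ cs)"
    and cover: "set (as @ bs @ cs) = V"
    and A: "A = {a, b, c}" "a \<in> set as" "b \<in> set bs" "c \<in> set cs"
  shows "\<exists>F. two_factor V E F \<and> separates F A"
proof (rule separating_two_factor)
  have ne: "as \<noteq> bs" "as \<noteq> cs" "bs \<noteq> cs" "a \<noteq> b" "a \<noteq> c" "b \<noteq> c"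
    using dist A by auto
  then show "card {as, bs, cs} = card A" using A(1) by simp
  show "card (A \<inter> set xs) = 1" if "xs \<in> {as, bs, cs}" for xs
  proof -
    have "A \<inter> set as = {a}" "A \<inter> set bs = {b}" "A \<inter> set cs = {c}"
      using dist A by auto
    then show ?thesis using that by auto
  qed
  show "disjoint_family_on set {as, bs, cs}"
    using dist by (auto simp: disjoint_family_on_def)
qed (use cyc dist cover in auto)

section \<open>From unreduced integers to residues\<close>

lemma circulant_edge_mod:
  assumes "n > 0" "d \<in> S" "(b - a) mod n = d mod n"
  shows "{a mod n, b mod n} \<in> circulant_edges n S"
proof -
  have "b mod n = (a mod n + d) mod n"
    using assms(3) by (metis diff_add_cancel mod_add_eq mod_add_left_eq add.commute)
  then show ?thesis
    using assms unfolding circulant_edges_def circulant_verts_def by force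
qed

lemma hd_upto: "i \<le> j \<Longrightarrow> hd [i..j] = i"
  by (simp add: upto_rec1)

lemma last_upto: "i \<le> j \<Longrightarrow> last [i..j] = j"
  by (simp add: upto_rec2)

lemma successively_upto:
  assumes "\<And>x. i \<le> x \<Longrightarrow> x < j \<Longrightarrow> P x (x + 1)"
  shows "successively P [i..j]"
  unfolding successively_conv_nth
proof (intro allI impI)
  fix k assume "Suc k < length [i..j]"
  then show "P ([i..j] ! k) ([i..j] ! Suc k)"
    using assms[of "i + int k"] by (simp add: algebra_simps)
qed

text \<open>Any \<open>n\<close> consecutive integers represent the vertices faithfully, so
  disjointness and covering can be checked on plain intervals.\<close>

lemma inj_on_mod_interval: "inj_on (\<lambda>x. x mod n) {i..<i + n}" for i n :: int
proof (rule inj_onI)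
  fix x y assume xy: "x \<in> {i..<i + n}" "y \<in> {i..<i + n}" "x mod n = y mod n"
  then have "n dvd x - y" by (simp add: mod_eq_dvd_iff)
  then show "x = y" using dvd_imp_le_int[of "x - y" n] xy(1,2) by (cases "x = y") auto
qed

lemma image_mod_interval: "(\<lambda>x. x mod n) ` {i..<i + n} = {0..<n}" if "n > 0" for i n :: int
proof (rule card_subset_eq)
  show "card ((\<lambda>x. x mod n) ` {i..<i + n}) = card {0..<n}"
    by (simp add: card_image[OF inj_on_mod_interval])
qed (use that in auto)

section \<open>Two quads and the cycle through the rest\<close>

definition quad :: "int \<Rightarrow> int \<Rightarrow> int set" where
  "quad s i = {i, i + 1, i + s, i + s + 1}"

lemma quads_and_rest:
  fixes n s :: int
  assumes s: "s \<ge> 3" and ij: "i + s + 3 \<le> j" "j + s + 3 \<le> i + n"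
    and abc: "a \<in> quad s i" "b \<in> quad s j" "c \<in> {i..<i + n} - quad s i - quad s j"
  shows "\<exists>F. two_factor (circulant_verts n) (circulant_edges n {1, -1, s, -s}) F
           \<and> separates F {a mod n, b mod n, c mod n}"
proof -
  let ?E = "circulant_edges n {1, -1, s, -s}" and ?m = "\<lambda>x. x mod n"
  have n: "n > 0" using s ij by simp
  \<comment> \<open>The difference \<open>s - n\<close> serves the jump from
    \<open>i + n - 1\<close> to \<open>i + s - 1\<close>, which wraps around the window
    \<open>{i..<i + n}\<close>.\<close>
  have E: "{x mod n, y mod n} \<in> ?E" if d: "y - x \<in> {1, -1, s, -s, s - n}" for x y
  proof -
    consider "y - x \<in> {1, -1, s, -s}" | "y - x = s - n"
      using d by auto
    then show ?thesis
    proof cases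
      case 1 then show ?thesis by (intro circulant_edge_mod[OF n]) auto
    next
      case 2 then show ?thesis by (intro circulant_edge_mod[OF n, of s]) auto
    qed
  qed
  define q where "q k = [k, k + 1, k + s + 1, k + s]" for k
  \<comment> \<open>Starting just behind the quad at \<open>i\<close> makes the jump from
    \<open>i + 2\<close> to \<open>i + s + 2\<close> the closing edge. All four segments are
    nonempty, by the bounds on \<open>i\<close>, \<open>j\<close> and \<open>s\<close>.\<close>
  define r where "r = [i + s + 2..j - 1] @ rev [j + 2..j + s - 1]
    @ [j + s + 2..i + n - 1] @ rev [i + 2..i + s - 1]"
  have setq: "set (q k) = quad s k" for k by (auto simp: q_def quad_def)
  have setr: "set r = {i..<i + n} - quad s i - quad s j"
  proof (rule set_eqI)
    fix x show "x \<in> set r \<longleftrightarrow> x \<in> {i..<i + n} - quad s i - quad s j"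
      unfolding r_def quad_def set_append set_rev set_upto Un_iff Diff_iff insert_iff
        atLeastAtMost_iff atLeastLessThan_iff empty_iff
      using s ij by smt
  qed
  have "distinct (q i @ q j @ r)"
    using s ij by (auto simp: q_def r_def)
  moreover have set: "set (q i @ q j @ r) = {i..<i + n}"
    using s ij by (auto simp: setq setr quad_def)
  ultimately have "distinct (map ?m (q i @ q j @ r))"
    using inj_on_mod_interval by (simp only: distinct_map simp_thms)
  moreover have "set (map ?m (q i @ q j @ r)) = circulant_verts n"
    using set image_mod_interval[OF n] by (simp only: circulant_verts_def set_map)
  moreover have "length (q k) \<ge> 3 \<and> cycle_edges (map ?m (q k)) \<subseteq> ?E" for k
    by (intro conjI cycle_edges_subset) (auto simp: q_def intro!: E)
  moreover have "length r \<ge> 3"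
    using s ij by (simp add: r_def)
  moreover have "cycle_edges (map ?m r) \<subseteq> ?E"
  proof (rule cycle_edges_subset)
    have up: "successively (\<lambda>x y. {x mod n, y mod n} \<in> ?E) [k..l]"
      and down: "successively (\<lambda>x y. {y mod n, x mod n} \<in> ?E) [k..l]" for k l
      by (auto intro!: successively_upto E)
    show "successively (\<lambda>x y. {x, y} \<in> ?E) (map ?m r)"
      unfolding r_def successively_map successively_append_iff successively_rev
      using s ij by (auto simp: up down hd_upto last_upto last_rev hd_rev intro!: E)
    show "{last (map ?m r), hd (map ?m r)} \<in> ?E"
    proof -
      have "[i + s + 2..j - 1] \<noteq> []" "[i + 2..i + s - 1] \<noteq> []" using s ij by auto
      then have "hd r = i + s + 2" "last r = i + 2" "r \<noteq> []"
        using s ij by (auto simp: r_def last_rev hd_upto)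
      then show ?thesis by (auto simp: last_map hd_map intro!: E)
    qed
  qed
  ultimately show ?thesis
    using abc
    by (intro separating_two_factor_3[where as = "map ?m (q i)" and bs = "map ?m (q j)"
          and cs = "map ?m r" and a = "a mod n" and b = "b mod n" and c = "c mod n"])
       (auto simp: setq setr)
qed

section \<open>Choice of the quads\<close>

lemma choose_quads:
  fixes n s x y z :: int
  assumes "s \<ge> 3" "n \<ge> 4 * s + 3" "n \<noteq> 15 \<or> s \<noteq> 3"
    and "x < y" "y < z" "y - x \<le> x + n - z" "z - y \<le> x + n - z"
  obtains i j where "i + s + 3 \<le> j" "j + s + 3 \<le> i + n"
    "x \<in> quad s i" "z \<in> quad s j" "y \<in> {i..<i + n} - quad s i - quad s j"
proof -
  define P where "P i j \<longleftrightarrow> i + s + 3 \<le> j \<and> j + s + 3 \<le> i + n \<and>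
    x \<in> quad s i \<and> z \<in> quad s j \<and> y \<in> {i..<i + n} - quad s i - quad s j" for i j
  have "\<exists>i j. P i j"
  proof -
    consider "z - x \<le> n - 2 * s - 4" | "z - x > n - 2 * s - 4" "x + n - z \<le> s + 3"
      | "z - x > n - 2 * s - 4" "x + n - z > s + 3" by linarith
    then show ?thesis
    proof cases
      \<comment> \<open>The outer gap has room for both quads, pointing away from
        \<open>y\<close>.\<close>
      case 1
      then have "P (x - s - 1) z"
        using assms by (simp add: P_def quad_def)
      then show ?thesis by blast
    next
      case 2
      \<comment> \<open>The largest gap is at least \<open>n / 3\<close>, and
        \<open>n \<ge> 4 * s + 3\<close> makes this exceed \<open>s + 2\<close> unless
        \<open>n = 15\<close> and \<open>s = 3\<close>. So the gap is exactly \<open>s + 3\<close>,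
        just enough for quads shifted by one; the other two gaps are then long enough for
        \<open>y\<close> to avoid them.\<close>
      then have "x + n - z = s + 3" "y - x > s" "z - y > 1"
        using assms by linarith+
      then have "P (x - 1) (z - 1)"
        using assms(1,2) by (simp add: P_def quad_def)
      then show ?thesis by blast
    next
      case 3
      \<comment> \<open>Each placement fails only if \<open>y\<close> hits a quad:
        \<open>z - s\<close>, \<open>z - s + 1\<close> block the first, \<open>x + s - 1\<close>,
        \<open>x + s\<close> the second.\<close>
      consider "y \<noteq> z - s" "y \<noteq> z - s + 1" | "y \<in> {z - s, z - s + 1}" "y \<noteq> x + s - 1" "y \<noteq> x + s"
        | "y \<in> {z - s, z - s + 1}" "y \<in> {x + s - 1, x + s}" by blast
      then show ?thesis
      proof cases
        case 1
        then have "P (x - s - 1) (z - s)"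
          using assms 3 by (simp add: P_def quad_def)
        then show ?thesis by blast
      next
        case 2
        then have "P (x - 1) (z - 1)"
          using assms 3 by (auto simp: P_def quad_def)
        then show ?thesis by blast
      next
        case 3
        \<comment> \<open>Being blocked twice forces \<open>z - x \<le> 2 * s\<close>, so the outer
          gap is at least \<open>2 * s + 3\<close>, exactly what this placement requires.\<close>
        then have "P (x - s) z"
          using assms by (auto simp: P_def quad_def)
        then show ?thesis by blast
      qed
    qed
  qed
  then show thesis
    using that unfolding P_def by blast
qed

text \<open>Rotation moves the largest gap to the end; the representatives may exceed
  \<open>n\<close>, which keeps them in increasing order.\<close>

lemma cyclic_triple:
  assumes "A \<subseteq> circulant_verts n" "card A = 3"
  obtains x y z where "x < y" "y < z" "z < x + n" "y - x \<le> x + n - z" "z - y \<le> x + n - z"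
    "A = {x mod n, y mod n, z mod n}"
proof -
  have fin: "finite A" using assms(2) by (metis card.infinite zero_neq_numeral)
  obtain a b c where abc: "A = {a, b, c}" "a < b" "b < c"
  proof -
    have "length (sorted_list_of_set A) = 3" using assms(2) by simp
    then obtain a b c where l: "sorted_list_of_set A = [a, b, c]"
      by (auto simp: numeral_3_eq_3 length_Suc_conv simp del: length_sorted_list_of_set)
    have "A = {a, b, c}" using l set_sorted_list_of_set[OF fin] by simp
    moreover have "a < b \<and> b < c" using l strict_sorted_list_of_set[of A] by simp
    ultimately show thesis using that by blast
  qed
  then have bd: "0 \<le> a" "c < n" using assms(1) by (auto simp: circulant_verts_def)
  then have m: "a mod n = a" "b mod n = b" "c mod n = c" using abc by auto
  consider "b - a \<le> a + n - c \<and> c - b \<le> a + n - c" | "c - b \<le> b - a \<and> a + n - c \<le> b - a"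
    | "b - a \<le> c - b \<and> a + n - c \<le> c - b" by linarith
  then show thesis
  proof cases
    case 1 then show thesis using that[of a b c] abc bd m by simp
  next
    case 2 then show thesis using that[of b c "a + n"] abc bd m by (simp add: insert_commute)
  next
    case 3 then show thesis using that[of c "a + n" "b + n"] abc bd m by (simp add: insert_commute)
  qed
qed

theorem theorem5p4:
  fixes n s :: int
  assumes "s \<ge> 3" and "n \<ge> 4 * s + 3" and "gcd n s = 1"
  shows "spanning_cyclable 3 (circulant_verts n) (circulant_edges n {1, -1, s, -s})"
  unfolding spanning_cyclable_def
proof (intro allI impI, elim conjE)
  fix A :: "int set"
  assume A: "A \<subseteq> circulant_verts n" "card A = 3"
  obtain x y z where xyz: "x < y" "y < z" "z < x + n" "y - x \<le> x + n - z" "z - y \<le> x + n - z"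
    and A_eq: "A = {x mod n, y mod n, z mod n}"
    using cyclic_triple[OF A] .
  have "n \<noteq> 15 \<or> s \<noteq> 3" using assms(3) not_coprimeI[of 3 15 "3 :: int"] by auto
  then obtain i j where "i + s + 3 \<le> j" "j + s + 3 \<le> i + n"
    "x \<in> quad s i" "z \<in> quad s j" "y \<in> {i..<i + n} - quad s i - quad s j"
    using choose_quads[OF assms(1,2) _ xyz(1,2,4,5)] by metis
  then show "\<exists>F. two_factor (circulant_verts n) (circulant_edges n {1, -1, s, -s}) F
      \<and> separates F A"
    \<comment> \<open>The outer vertices \<open>x\<close> and \<open>z\<close> go into the quads,
      the middle one \<open>y\<close> onto the long cycle.\<close>
    using quads_and_rest[OF assms(1), of i j n x z y] by (simp add: A_eq insert_commute)
qed

end
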